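(* Let $g(t)=\sum_{n\ge0}g_nt^n$ and $f(t)=\sum_{n\ge1}f_nt^n$ be formal power series with $g_0=1$ and $f_1\neq0$, and let $(d_{n,k})_{n,k\ge0}=(g,f)$ be the associated Riordan array, i.e. $d_{n,k}=[t^n]\,g(t)f(t)^k$. Fix integers $p\ge1$ and $r\ge0$, and let $\phi(t)$ be the compositional inverse of the series $t^p/f(t)^{p-1}$. Then the matrix $(\tilde d_{n,k})_{n,k\ge0}$ with $\tilde d_{n,k}=d_{pn+r,\,(p-1)n+r+k}$ is a Riordan array, namely $$(\tilde d_{n,k})_{n,k\ge0}=\left(\frac{t\,\phi'(t)\,g(\phi(t))\,f(\phi(t))^r}{\phi(t)^{r+1}},\ f(\phi(t))\right).$$ In particular, for $p=1,r=0$ it equals $(g,f)$, and for $p=2,r=0$ it is the horizontal half Riordan array $(d_{2n,n+k})_{n,k\ge0}$. Moreover, if $A(t)$ is the generating function of the $A$-sequence of $(g,f)$, then the generating function of the $A$-sequence of $(\tilde d_{n,k})$ is $(A(t))^p$.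
   Context: A Riordan array $(g,f)$, for $g(0)=1$, $f(0)=0$, $f'(0)\neq0$, is the infinite lower triangular matrix whose $(n,k)$ entry is $[t^n]g(t)f(t)^k$. The $A$-sequence of $(g,f)$ is the sequence $(a_n)_{n\ge0}$ whose generating function $A(t)=\sum_{n\ge0}a_nt^n$ is determined by $f(t)=t\,A(f(t))$; equivalently every entry satisfies $d_{n+1,k+1}=\sum_{j\ge0}a_jd_{n,k+j}$.
   Formalization: For the new matrix, "Riordan array" means first component with nonzero constant term rather than g(0)=1, since that constant term equals f_1^r (also proved), which need not be 1 (e.g. g=1, f=2t, p=1, r=1 gives 2). *)

theory Defs
  imports "HOL-Computational_Algebra.Formal_Power_Series"
begin

unbundle fps_syntax

definition riordan_array :: "'a::field fps \<Rightarrow> 'a fps \<Rightarrow> nat \<Rightarrow> nat \<Rightarrow> 'a" where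
  "riordan_array g f = (\<lambda>n k. (g * f ^ k) $ n)"

(* Pairs (g,f) defining a Riordan array. Only g(0) \<noteq> 0 is required, not g(0) = 1: the array
   (d (p*n+r) ((p-1)*n+r+k)) extracted from (g,f) has the top left entry f_1 ^ r. *)
definition riordan_pair :: "'a::field fps \<Rightarrow> 'a fps \<Rightarrow> bool" where
  "riordan_pair g f \<longleftrightarrow> g $ 0 \<noteq> 0 \<and> f $ 0 = 0 \<and> f $ 1 \<noteq> 0"

(* D is a Riordan array (g,f), and A is the generating function of its A-sequence: f(t) = t A(f(t)).
   The pair (g,f) is determined by D, and A by f; see below. *)
definition A_sequence_gf :: "(nat \<Rightarrow> nat \<Rightarrow> 'a::field) \<Rightarrow> 'a fps \<Rightarrow> bool" where
  "A_sequence_gf D A \<longleftrightarrow>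
     (\<exists>g f. riordan_pair g f \<and> D = riordan_array g f \<and> f = fps_X * (A oo f))"

lemma riordan_array_inject:
  assumes "riordan_pair g f" and "riordan_array g f = riordan_array g' f'"
  shows "g = g' \<and> f = f'"
proof -
  have eq: "(g * f ^ k) $ n = (g' * f' ^ k) $ n" for n k
    using fun_cong[OF fun_cong[OF assms(2)]] by (simp add: riordan_array_def)
  have g: "g = g'"
    using eq[of 0] by (simp add: fps_eq_iff)
  have "g * f = g * f'"
    using eq[of 1] unfolding g by (simp add: fps_eq_iff)
  moreover have "g \<noteq> 0"
    using assms(1) by (auto simp: riordan_pair_def)
  ultimately show ?thesis
    using g by simp
qed

lemma A_sequence_gf_exists:
  assumes "riordan_pair g f"
  shows "\<exists>A. A_sequence_gf (riordan_array g f) A"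
proof -
  have f: "f $ 0 = 0" "f $ 1 \<noteq> 0"
    using assms by (auto simp: riordan_pair_def)
  have i0: "fps_inv f $ 0 = 0"
    by (simp add: fps_inv_def)
  define A where "A = fps_shift 1 f oo fps_inv f"
  have "A oo f = fps_shift 1 f oo (fps_inv f oo f)"
    unfolding A_def by (rule fps_compose_assoc[symmetric, OF f(1) i0])
  hence "fps_X * (A oo f) = f"
    using f by (simp add: fps_inv fps_eq_iff)
  thus ?thesis
    using assms unfolding A_sequence_gf_def by metis
qed

lemma A_sequence_gf_unique:
  assumes "A_sequence_gf D A" and "A_sequence_gf D B"
  shows "A = B"
proof -
  obtain g f where f: "riordan_pair g f" "D = riordan_array g f" "f = fps_X * (A oo f)"
    using assms(1) unfolding A_sequence_gf_def by blast
  have "f = fps_X * (B oo f)"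
    using assms(2) f(1,2) riordan_array_inject unfolding A_sequence_gf_def by metis
  hence "fps_X * (A oo f) = fps_X * (B oo f)"
    using f(3) by metis
  hence AB: "A oo f = B oo f"
    by simp
  have f01: "f $ 0 = 0" "f $ 1 \<noteq> 0"
    using f(1) by (auto simp: riordan_pair_def)
  have i0: "fps_inv f $ 0 = 0"
    by (simp add: fps_inv_def)
  have "C oo f oo fps_inv f = C" for C
    using fps_compose_assoc[OF i0 f01(1), of C] fps_inv_right[OF f01] by simp
  thus ?thesis
    using AB by metis
qed

end

theory Submission
  imports Defs
begin

text \<open>
  Put \<open>h = t\<^sup>p / f\<^bsup>p-1\<^esup>\<close>, so that \<open>\<phi>\<close> is its inverse, and write \<open>f = t s\<close>. Substituting \<open>h\<close> for
  \<open>t\<close> turns \<open>F\<close> into \<open>f\<close> and \<open>G\<close> into \<open>h g s\<^sup>r / (t h')\<close>, so Lagrange inversion in the residue form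
  \<open>[t\<^sup>n] H = [t\<^sup>n] h' H(h) (t/h)\<^bsup>n+1\<^esup>\<close> applied to \<open>H = G F\<^sup>k\<close> gives
  \<open>[t\<^sup>n] g s\<^sup>r f\<^sup>k s\<^bsup>(p-1)n\<^esup>\<close>, which is \<open>d\<close> at the required indices. For the A-sequence,
  \<open>h(\<phi>) = t\<close> reads \<open>\<phi>\<^sup>p = t F\<^bsup>p-1\<^esup>\<close>, while \<open>f = t A(f)\<close> gives \<open>F = \<phi> A(F)\<close>; raise the latter to the
  power \<open>p\<close> and cancel \<open>F\<^bsup>p-1\<^esup>\<close>.
\<close>

text \<open>As \<open>h ^ m\<close> has order at least \<open>m\<close>, only
  \<open>m \<le> n\<close> contributes, so statements about \<open>H oo h\<close> reduce to finitely
  many powers of \<open>h\<close>.\<close>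

lemma fps_compose_mult_nth:
  fixes H h Y :: "'a::idom fps"
  assumes "h $ 0 = 0"
  shows "((H oo h) * Y) $ n = (\<Sum>m\<le>n. H $ m * (h ^ m * Y) $ n)"
proof -
  have "(H oo h) $ i = (\<Sum>m\<le>n. H $ m * (h ^ m $ i))" if "i \<le> n" for i
    unfolding fps_compose_nth using that assms
    by (intro sum.mono_neutral_left) (auto simp: startsby_zero_power_prefix)
  hence "((H oo h) * Y) $ n = (\<Sum>i=0..n. \<Sum>m\<le>n. H $ m * (h ^ m $ i * Y $ (n - i)))"
    by (simp add: fps_mult_nth sum_distrib_right mult.assoc)
  also have "\<dots> = (\<Sum>m\<le>n. H $ m * (h ^ m * Y) $ n)"
    by (subst sum.swap) (simp add: fps_mult_nth sum_distrib_left)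
  finally show ?thesis .
qed

text \<open>With \<open>v\<close> = t/h this coefficient is the residue of h'/h^(j+1): for j > 0
  that is the derivative of -1/(j h^j), which has no residue; for j = 0 it is the logarithmic
  derivative of a series of order 1.\<close>

lemma fps_deriv_mult_power_nth:
  fixes h v :: "'a::field_char_0 fps"
  assumes "h $ 0 = 0" and hv: "h * v = fps_X"
  shows "(fps_deriv h * v ^ Suc j) $ j = (if j = 0 then 1 else 0)"
proof -
  have D: "fps_deriv h * v + h * fps_deriv v = 1"
    using arg_cong[OF hv, of fps_deriv] by (simp add: algebra_simps)
  show ?thesis
  proof (cases j)
    case 0
    thus ?thesis
      using arg_cong[OF D, of "\<lambda>x. x $ 0"] assms(1) by simp
  next
    case (Suc i)
    have "fps_deriv h * v ^ Suc j = (fps_deriv h * v + h * fps_deriv v) * v ^ Suc i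
        - (h * v) * (fps_deriv v * v ^ i)"
      by (simp add: Suc algebra_simps)
    hence E: "fps_deriv h * v ^ Suc j = v ^ Suc i - fps_X * (fps_deriv v * v ^ i)"
      by (simp only: D hv mult_1_left)
    \<comment> \<open>Both terms of \<open>E\<close> have the same coefficient at \<open>j\<close>,
      by comparing coefficients in the derivative of \<open>v ^ Suc i\<close>; cancelling
      \<open>Suc i\<close> needs characteristic 0.\<close>
    have "of_nat (Suc i) * (fps_deriv v * v ^ i) $ i = fps_deriv (v ^ Suc i) $ i"
      by (simp only: fps_deriv_power diff_Suc_1 mult.assoc fps_mult_left_const_nth)
    also have "\<dots> = of_nat (Suc i) * (v ^ Suc i) $ Suc i"
      by (simp only: fps_deriv_nth Suc_eq_plus1)
    finally have "(fps_deriv v * v ^ i) $ i = (v ^ Suc i) $ Suc i"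
      by (simp only: mult_cancel_left of_nat_eq_0_iff nat.distinct) simp
    thus ?thesis
      unfolding E using Suc by simp
  qed
qed

lemma fps_lagrange_inversion:
  fixes H h v :: "'a::field_char_0 fps"
  assumes h0: "h $ 0 = 0" and hv: "h * v = fps_X"
  shows "H $ n = (fps_deriv h * (H oo h) * v ^ Suc n) $ n"
proof -
  \<comment> \<open>Here \<open>h ^ m\<close> absorbs \<open>m\<close> factors \<open>v\<close> and
    leaves t^m, which shifts the residue computation to index \<open>n - m\<close>.\<close>
  have *: "(h ^ m * (fps_deriv h * v ^ Suc n)) $ n = (if m = n then 1 else 0)" if "m \<le> n" for m
  proof -
    have "v ^ Suc n = v ^ m * v ^ Suc (n - m)"
      using that by (simp flip: power_add)
    hence "h ^ m * (fps_deriv h * v ^ Suc n) = (h * v) ^ m * (fps_deriv h * v ^ Suc (n - m))"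
      by (simp only: power_mult_distrib ac_simps)
    thus ?thesis
      unfolding hv using that
      by (simp only: fps_X_power_mult_nth fps_deriv_mult_power_nth[OF h0 hv]) auto
  qed
  have "(fps_deriv h * (H oo h) * v ^ Suc n) $ n = ((H oo h) * (fps_deriv h * v ^ Suc n)) $ n"
    by (simp only: ac_simps)
  also have "\<dots> = (\<Sum>m\<le>n. H $ m * (if m = n then 1 else 0))"
    unfolding fps_compose_mult_nth[OF h0] by (intro sum.cong) (simp_all only: * atMost_iff)
  also have "\<dots> = H $ n"
    by (simp add: mult_delta_right)
  finally show ?thesis ..
qed

theorem theorem2p2:
  fixes g f \<phi> G F :: "'a::field_char_0 fps"
    and d dt :: "nat \<Rightarrow> nat \<Rightarrow> 'a"
    and p r :: nat
  assumes "g $ 0 = 1" and "f $ 0 = 0" and "f $ 1 \<noteq> 0"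
    and "p \<ge> 1"
    and "d = riordan_array g f"
    and "\<phi> = fps_inv (fps_X ^ p / f ^ (p - 1))"
    and "dt = (\<lambda>n k. d (p * n + r) ((p - 1) * n + r + k))"
    and "G = (fps_X * fps_deriv \<phi> * (g oo \<phi>) * (f oo \<phi>) ^ r) / \<phi> ^ (r + 1)"
    and "F = f oo \<phi>"
  shows "riordan_pair G F \<and> G $ 0 = (f $ 1) ^ r
       \<and> dt = riordan_array G F
       \<and> (p = 1 \<and> r = 0 \<longrightarrow> dt = riordan_array g f)
       \<and> (p = 2 \<and> r = 0 \<longrightarrow> dt = (\<lambda>n k. d (2 * n) (n + k)))
       \<and> (\<forall>A. A_sequence_gf d A \<longrightarrow> A_sequence_gf dt (A ^ p))"
proof -
  obtain q where p: "p = Suc q"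
    using \<open>p \<ge> 1\<close> by (cases p) auto
  define h where "h = fps_X ^ p / f ^ q"
  define s where "s = fps_shift 1 f"
  \<comment> \<open>A unit with h = t w; its inverse \<open>s ^ q\<close> = t/h plays the role of
    \<open>v\<close> in the inversion lemma.\<close>
  define w where "w = inverse s ^ q"
  have s0: "s $ 0 = f $ 1"
    by (simp add: s_def)
  have f: "f = fps_X * s"
    using \<open>f $ 0 = 0\<close> by (simp add: s_def fps_eq_iff)
  have "f \<noteq> 0"
    using \<open>f $ 1 \<noteq> 0\<close> by auto
  have ws: "w * s ^ q = 1"
    using s0 \<open>f $ 1 \<noteq> 0\<close> by (simp add: w_def inverse_mult_eq_1 flip: power_mult_distrib)
  have w0: "w $ 0 \<noteq> 0"
    using s0 \<open>f $ 1 \<noteq> 0\<close> by (simp add: w_def fps_nth_power_0)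
  have "fps_X ^ p = fps_X * w * f ^ q"
    using ws by (simp add: p f power_mult_distrib ac_simps)
  hence h: "h = fps_X * w"
    using \<open>f \<noteq> 0\<close> by (simp add: h_def)
  have h0: "h $ 0 = 0" and h1: "h $ 1 \<noteq> 0"
    using w0 by (simp_all add: h)
  have hv: "h * s ^ q = fps_X"
    by (simp add: h ws mult.assoc)
  have \<phi>: "\<phi> = fps_inv h"
    using assms(6) by (simp add: h_def p)
  have \<phi>0: "\<phi> $ 0 = 0"
    by (simp add: \<phi> fps_inv_def)
  have \<phi>h: "\<phi> oo h = fps_X" and h\<phi>: "h oo \<phi> = fps_X"
    using fps_inv fps_inv_right h0 h1 by (auto simp: \<phi>)
  have "\<phi> \<noteq> 0"
    using h\<phi> h0 by auto
  have X\<phi>: "fps_X = \<phi> * (w oo \<phi>)"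
    using h\<phi> by (simp add: h fps_compose_mult_distrib \<phi>0)
  have F: "F = \<phi> * (s oo \<phi>)"
    by (simp add: assms(9) f fps_compose_mult_distrib \<phi>0)
  have Fh: "F oo h = f"
    by (simp add: assms(9) \<phi>h flip: fps_compose_assoc[OF h0 \<phi>0])
  \<comment> \<open>The factor t supplies one \<phi> and the power of \<open>f oo \<phi>\<close>
    supplies r more, so the division defining \<open>G\<close> is exact.\<close>
  have "fps_X * fps_deriv \<phi> * (g oo \<phi>) * (f oo \<phi>) ^ r
      = (w oo \<phi>) * fps_deriv \<phi> * (g oo \<phi>) * (s oo \<phi>) ^ r * \<phi> ^ (r + 1)"
    by (subst X\<phi>) (simp only: F assms(9)[symmetric] power_mult_distrib power_add power_one_right
          ac_simps)
  hence G: "G = (w oo \<phi>) * fps_deriv \<phi> * (g oo \<phi>) * (s oo \<phi>) ^ r"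
    using \<open>\<phi> \<noteq> 0\<close> by (simp only: assms(8)) simp
  have cc: "(a oo \<phi>) oo h = a" for a
    by (simp add: \<phi>h flip: fps_compose_assoc[OF h0 \<phi>0])
  have dd: "fps_deriv h * (fps_deriv \<phi> oo h) = 1"
    using arg_cong[OF \<phi>h, of fps_deriv] fps_compose_deriv[OF h0, of \<phi>] by (simp add: mult.commute)
  have "G oo h = w * (fps_deriv \<phi> oo h) * g * s ^ r"
    by (simp add: G fps_compose_mult_distrib h0 cc flip: fps_compose_power)
  hence "fps_deriv h * (G oo h) = (fps_deriv h * (fps_deriv \<phi> oo h)) * (w * g * s ^ r)"
    by (simp only: ac_simps)
  hence Gh: "fps_deriv h * (G oo h) = w * g * s ^ r"
    by (simp only: dd mult_1_left)

  have "F $ 1 \<noteq> 0"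
  proof
    assume "F $ 1 = 0"
    hence "(F oo h) $ 1 = 0"
      by (simp add: fps_compose_nth)
    thus False
      using Fh \<open>f $ 1 \<noteq> 0\<close> by simp
  qed
  moreover have "F $ 0 = 0"
    by (simp add: F \<phi>0)
  moreover have G0: "G $ 0 = (f $ 1) ^ r"
  proof -
    \<comment> \<open>In the constant term of \<open>Gh\<close> the factor \<open>w $ 0\<close>
      cancels, leaving \<open>s $ 0\<close> to the power r.\<close>
    have "fps_deriv h $ 0 = w $ 0"
      by (simp add: h)
    with arg_cong[OF Gh, of "\<lambda>x. x $ 0"] w0 show ?thesis
      using s0 \<open>g $ 0 = 1\<close> by (simp add: fps_nth_power_0)
  qed
  ultimately have pair: "riordan_pair G F"
    using \<open>f $ 1 \<noteq> 0\<close> by (simp add: riordan_pair_def)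

  have "dt n k = riordan_array G F n k" for n k
  proof -
    have "(G * F ^ k) $ n = (fps_deriv h * ((G * F ^ k) oo h) * (s ^ q) ^ Suc n) $ n"
      by (rule fps_lagrange_inversion[OF h0 hv])
    also have "fps_deriv h * ((G * F ^ k) oo h) = w * g * s ^ r * f ^ k"
      by (simp add: fps_compose_mult_distrib h0 Fh Gh flip: fps_compose_power mult.assoc)
    \<comment> \<open>One of the n + 1 factors \<open>s ^ q\<close> cancels
      \<open>w\<close>.\<close>
    also have "w * g * s ^ r * f ^ k * (s ^ q) ^ Suc n
        = (w * s ^ q) * (g * f ^ k * s ^ (q * n + r))"
      by (simp add: power_add ac_simps flip: power_mult)
    also have "\<dots> = g * f ^ k * s ^ (q * n + r)"
      by (simp add: ws)
    \<comment> \<open>Multiplying by this power of t turns each \<open>s\<close> back into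
      \<open>f\<close> and moves the index to n + qn + r = pn + r.\<close>
    also have "\<dots> $ n = (fps_X ^ (q * n + r) * (g * f ^ k * s ^ (q * n + r))) $ (p * n + r)"
      by (simp add: fps_X_power_mult_nth p)
    also have "fps_X ^ (q * n + r) * (g * f ^ k * s ^ (q * n + r)) = g * f ^ (q * n + r + k)"
      by (simp add: f power_add power_mult_distrib ac_simps)
    finally show ?thesis
      by (simp add: assms(5,7) riordan_array_def p)
  qed
  hence dt: "dt = riordan_array G F"
    by blast

  have "A_sequence_gf dt (A ^ p)" if "A_sequence_gf d A" for A
  proof -
    from that obtain g' f' where
      A: "riordan_pair g' f'" "d = riordan_array g' f'" "f' = fps_X * (A oo f')"
      unfolding A_sequence_gf_def by blast
    \<comment> \<open>The pair witnessing the A-sequence is not given as \<open>(g, f)\<close>; the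
      array determines it.\<close>
    have "f' = f"
      using riordan_array_inject[OF A(1), of g f] A(2) assms(5) by simp
    hence "f = fps_X * (A oo f)"
      using A(3) by simp
    hence "F = fps_X * (A oo f) oo \<phi>"
      using assms(9) by simp
    also have "\<dots> = \<phi> * (A oo F)"
      using \<open>f $ 0 = 0\<close> \<phi>0 by (simp add: fps_compose_mult_distrib assms(9) fps_compose_assoc)
    finally have "F ^ p = \<phi> ^ p * (A oo F) ^ p"
      by (metis power_mult_distrib)
    moreover have "fps_X * F ^ q = \<phi> ^ p"
    proof -
      have "fps_X * F ^ q = h * f ^ q oo \<phi>"
        by (simp add: fps_compose_mult_distrib \<phi>0 h\<phi> assms(9) fps_compose_power)
      also have "h * f ^ q = fps_X ^ p"
        using hv by (simp add: f p power_mult_distrib ac_simps)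
      finally show ?thesis
        by (simp add: \<phi>0 flip: fps_compose_power)
    qed
    ultimately have "F * F ^ q = (fps_X * (A oo F) ^ p) * F ^ q"
      by (simp add: p ac_simps)
    moreover have "F \<noteq> 0"
      using \<open>F $ 1 \<noteq> 0\<close> by auto
    ultimately have "F = fps_X * (A ^ p oo F)"
      using \<open>F $ 0 = 0\<close> by (simp add: fps_compose_power)
    thus ?thesis
      using pair dt unfolding A_sequence_gf_def by blast
  qed
  thus ?thesis
    using pair G0 dt assms(5,7) by (auto simp: numeral_2_eq_2)
qed

end
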